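(* Let $\phi\in\mathscr{L}$, and let $\mathcal{S}^*$ be the set of global optimal solutions of the problem $$\min_{x,w\in\mathbb{R}^p}\Big\{F_{\mu}(x)+\nu\sum_{i=1}^p\phi(w_i)\ \ \text{s.t.}\ \ \langle e-w,|x|\rangle=0,\ x\in\Omega,\ w\in[0,e]\Big\}.\qquad (P)$$ Then problem $(P)$ is partially calm over $\mathcal{S}^*$.
   Context: Data: $f:\mathbb{R}^n\to\mathbb{R}_+$ is a piecewise linear-quadratic (nonsmooth) convex function, $A\in\mathbb{R}^{n\times p}$, $b\in\mathbb{R}^n$, $\Omega\subseteq\mathbb{R}^p$ is a nonempty polyhedral (convex) set, $\mu>0$, $\nu>0$, and $F_\mu(x):=f(Ax-b)+\frac{\mu}{2}\|x\|^2$ for $x\in\mathbb{R}^p$. $e$ is the vector of all ones, $|x|$ is the vector of absolute values of the entries of $x$, and $[0,e]$ is the box $\{w\in\mathbb{R}^p: 0\le w_i\le 1\ \forall i\}$. $\mathscr{L}$ is the family of proper lower semicontinuous functions $\phi:\mathbb{R}\to(-\infty,+\infty]$ with ${\rm int}({\rm dom}\,\phi)\supseteq[0,1]$ which are convex in the interval $[0,1]$ and satisfy: $\phi$ has a unique minimizer $t^*:=\arg\min_{0\le t\le 1}\phi(t)$ over $[0,1]$, with $t^*<1$, $\phi(t^* )=0$ and $\phi(1)=1$. Partial calmness: for $\epsilon\in\mathbb{R}$ let $\mathcal{S}_\epsilon:=\{(x,w)\in\Omega\times[0,e]: \langle e-w,|x|\rangle=\epsilon\}$. Problem $(P)$ is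 partially calm at $(x^*,w^* )\in\mathcal{S}^*$ if there exist $\delta>0$ and $\rho>0$ such that for all $\epsilon\ge 0$ and all $(x,w)\in\mathbb{B}((x^*,w^* ),\delta)\cap\mathcal{S}_\epsilon$ (with $\mathbb{B}(z,\delta)$ the closed ball of center $z$ and radius $\delta$), $$\Big[F_\mu(x)+\nu\sum_{i=1}^p\phi(w_i)\Big]-\Big[F_\mu(x^* )+\nu\sum_{i=1}^p\phi(w_i^* )\Big]+\rho\nu\langle e-w,|x|\rangle\ge 0 .$$ Problem $(P)$ is partially calm over $\mathcal{S}^*$ if it is partially calm at every point of $\mathcal{S}^*$.
   Formalization: The formal statement additionally assumes that φ has a finite left derivative at 1; for φ in the family as defined (convex only in [0,1]) the claim fails, e.g. for φ(t) = 1 − √(1−t) on [0,1] and φ(t) = 2 for t > 1. *)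

theory Defs
  imports "HOL-Analysis.Analysis"
begin

(* Rockafellar-Wets, Definition 10.20, for finite-valued f: the domain, which the polyhedral
   pieces have to cover, is the whole space. *)
definition piecewise_linear_quadratic :: "(real^'n \<Rightarrow> real) \<Rightarrow> bool" where
  "piecewise_linear_quadratic f \<longleftrightarrow>
     (\<exists>\<P>. finite \<P> \<and> \<Union>\<P> = UNIV \<and>
        (\<forall>S\<in>\<P>. polyhedron S \<and>
           (\<exists>(C::real^'n^'n) a \<alpha>. transpose C = C \<and>
              (\<forall>y\<in>S. f y = (1/2) * (y \<bullet> (C *v y)) + a \<bullet> y + \<alpha>))))"

definition F_mu ::
  "(real^'n \<Rightarrow> real) \<Rightarrow> real^'p^'n \<Rightarrow> real^'n \<Rightarrow> real \<Rightarrow> real^'p \<Rightarrow> real" where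
  "F_mu f A b \<mu> x = f (A *v x - b) + \<mu> / 2 * (norm x)\<^sup>2"

definition edom :: "(real \<Rightarrow> ereal) \<Rightarrow> real set" where
  "edom \<phi> = {t. \<phi> t < \<infinity>}"

definition proper :: "(real \<Rightarrow> ereal) \<Rightarrow> bool" where
  "proper \<phi> \<longleftrightarrow> (\<forall>t. \<phi> t > -\<infinity>) \<and> edom \<phi> \<noteq> {}"

definition lsc :: "(real \<Rightarrow> ereal) \<Rightarrow> bool" where
  "lsc \<phi> \<longleftrightarrow> (\<forall>t. \<phi> t \<le> Liminf (at t) \<phi>)"

(* phi takes real values on {0..1} because it is proper and {0..1} lies in its domain, so that
   passing to real_of_ereal in the convexity clause loses nothing.  No condition is put on phi
   outside {0..1} beyond properness, lower semicontinuity and finiteness near {0..1}. *)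
definition family_L :: "(real \<Rightarrow> ereal) set" where
  "family_L = {\<phi>. proper \<phi> \<and> lsc \<phi> \<and> {0..1} \<subseteq> interior (edom \<phi>) \<and>
     convex_on {0..1} (\<lambda>t. real_of_ereal (\<phi> t)) \<and>
     (\<exists>t\<^sub>0. {t \<in> {0..1}. \<forall>s\<in>{0..1}. \<phi> t \<le> \<phi> s} = {t\<^sub>0} \<and> t\<^sub>0 < 1 \<and> \<phi> t\<^sub>0 = 0) \<and>
     \<phi> 1 = 1}"

(* Here 1 :: real^'p is the all-ones vector e, and the order and the absolute value on real^'p are
   componentwise, so that {0..1} is the box [0,e]. *)
definition S_eps :: "(real^'p) set \<Rightarrow> real \<Rightarrow> ((real^'p) \<times> (real^'p)) set" where
  "S_eps \<Omega> \<epsilon> = {(x, w). x \<in> \<Omega> \<and> w \<in> {0..1} \<and> (1 - w) \<bullet> \<bar>x\<bar> = \<epsilon>}"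

definition P_obj ::
  "(real^'p \<Rightarrow> real) \<Rightarrow> real \<Rightarrow> (real \<Rightarrow> ereal) \<Rightarrow> (real^'p) \<times> (real^'p) \<Rightarrow> ereal" where
  "P_obj F \<nu> \<phi> = (\<lambda>(x, w). ereal (F x) + ereal \<nu> * (\<Sum>i\<in>UNIV. \<phi> (w $ i)))"

definition S_star ::
  "(real^'p \<Rightarrow> real) \<Rightarrow> real \<Rightarrow> (real \<Rightarrow> ereal) \<Rightarrow> (real^'p) set
     \<Rightarrow> ((real^'p) \<times> (real^'p)) set" where
  "S_star F \<nu> \<phi> \<Omega> = {z \<in> S_eps \<Omega> 0. \<forall>z'\<in>S_eps \<Omega> 0. P_obj F \<nu> \<phi> z \<le> P_obj F \<nu> \<phi> z'}"

definition partially_calm_at ::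
  "(real^'p \<Rightarrow> real) \<Rightarrow> real \<Rightarrow> (real \<Rightarrow> ereal) \<Rightarrow> (real^'p) set
     \<Rightarrow> (real^'p) \<times> (real^'p) \<Rightarrow> bool" where
  "partially_calm_at F \<nu> \<phi> \<Omega> z \<longleftrightarrow>
     (\<exists>\<delta>>0. \<exists>\<rho>>0. \<forall>\<epsilon>\<ge>0. \<forall>(x, w) \<in> cball z \<delta> \<inter> S_eps \<Omega> \<epsilon>.
        P_obj F \<nu> \<phi> (x, w) - P_obj F \<nu> \<phi> z + ereal (\<rho> * \<nu> * ((1 - w) \<bullet> \<bar>x\<bar>)) \<ge> 0)"

definition partially_calm_over ::
  "(real^'p \<Rightarrow> real) \<Rightarrow> real \<Rightarrow> (real \<Rightarrow> ereal) \<Rightarrow> (real^'p) set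
     \<Rightarrow> ((real^'p) \<times> (real^'p)) set \<Rightarrow> bool" where
  "partially_calm_over F \<nu> \<phi> \<Omega> S \<longleftrightarrow> (\<forall>z\<in>S. partially_calm_at F \<nu> \<phi> \<Omega> z)"

end

theory Submission
  imports Defs
begin

text \<open>
  Partial calmness is a local exact penalty property: near an optimum, leaving the constraint
  \<open>\<langle>e - w, |x|\<rangle> = 0\<close> lowers the objective by at most a multiple of the constraint violation.
  Write \<open>F\<close> for the part \<open>F_mu f A b \<mu>\<close> of the objective that depends on \<open>x\<close>.  Fix an
  optimal \<open>(x\<^sub>0, w\<^sub>0)\<close> and let \<open>J\<close> be the set of zero coordinates of \<open>x\<^sub>0\<close>.  The constraint
  and optimality force \<open>w\<^sub>0\<close> to be \<open>1\<close> off \<open>J\<close> and the minimizer \<open>t\<^sub>0\<close> of \<open>\<phi>\<close> on \<open>J\<close>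
  (\<open>S_star_weight\<close>).  Near this point the coordinates behave in two ways.

  Off \<open>J\<close>, \<open>|x\<^sub>i|\<close> is bounded away from \<open>0\<close>, so the violation dominates \<open>1 - w\<^sub>i\<close>, while
  \<open>\<phi> w\<^sub>i\<close> drops below \<open>\<phi> 1\<close> at most linearly in \<open>1 - w\<^sub>i\<close> because a convex function lies
  above its left tangent (\<open>convex_on_above_left_tangent\<close>).  This is where the finite left
  derivative of \<open>\<phi>\<close> at \<open>1\<close> enters.

  On \<open>J\<close>, \<open>1 - w\<^sub>i\<close> is bounded away from \<open>0\<close> because \<open>t\<^sub>0 < 1\<close>, so the violation dominates
  \<open>|x\<^sub>i|\<close>, and \<open>\<phi> w\<^sub>i\<close> cannot drop below \<open>\<phi> t\<^sub>0 = 0\<close>.  It remains to compensate a possible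
  decrease of \<open>F\<close> by a multiple of \<open>\<Sum>i\<in>J. |x\<^sub>i|\<close>.  Keeping \<open>w = w\<^sub>0\<close> shows that \<open>x\<^sub>0\<close>
  minimizes \<open>F\<close> over the points of \<open>\<Omega>\<close> vanishing on \<open>J\<close> (\<open>S_star_point_optimal\<close>).  A
  Hoffman-type error bound puts such a point within a multiple of \<open>\<Sum>i\<in>J. |x\<^sub>i|\<close> of \<open>x\<close>
  (\<open>polytope_coordinate_error_bound\<close>), and \<open>F\<close> is Lipschitz on bounded sets because it is
  convex; together these give \<open>convex_exact_penalty\<close>.
\<close>

section \<open>Lipschitz continuity of convex functions\<close>

text \<open>
  Extend the segment from \<open>x\<close> to \<open>y\<close> by one unit beyond \<open>y\<close>.  Convexity bounds the slope
  between \<open>x\<close> and \<open>y\<close> by the slope on the added unit, and that is at most twice a bound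
  of \<open>|F|\<close> on the ball enlarged by \<open>1\<close>.
\<close>

lemma convex_on_UNIV_lipschitz_on_cball:
  fixes F :: "'a::euclidean_space \<Rightarrow> real"
  assumes conv: "convex_on UNIV F"
  shows "\<exists>L. L-lipschitz_on (cball c r) F"
proof -
  have "continuous_on UNIV F"
    using conv convex_on_continuous open_UNIV by blast
  then have "compact (F ` cball c (r + 1))"
    by (meson compact_cball compact_continuous_image continuous_on_subset subset_UNIV)
  then have "bounded (F ` cball c (r + 1))" by (rule compact_imp_bounded)
  then obtain B where B: "\<And>x. x \<in> cball c (r + 1) \<Longrightarrow> \<bar>F x\<bar> \<le> B"
    unfolding bounded_iff by (metis imageI real_norm_def)
  have onesided: "F y - F x \<le> 2 * \<bar>B\<bar> * dist x y"
    if x: "x \<in> cball c r" and y: "y \<in> cball c r" for x y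
  proof (cases "x = y")
    case False
    define t where "t = norm (y - x)"
    have t: "t > 0" using False by (simp add: t_def)
    have norm_t: "norm (y - x) = t" by (simp add: t_def)
    define z where "z = y + (1 / t) *\<^sub>R (y - x)"
    have "dist c z \<le> dist c y + dist y z" by (rule dist_triangle)
    also have "dist y z = 1"
      using False t by (simp add: z_def dist_norm norm_t)
    finally have z: "z \<in> cball c (r + 1)" using y by simp
    have y_eq: "y = (1 / (1 + t)) *\<^sub>R x + (t / (1 + t)) *\<^sub>R z"
    proof -
      have "(t / (1 + t)) *\<^sub>R z = (t / (1 + t)) *\<^sub>R y + (1 / (1 + t)) *\<^sub>R (y - x)"
        using t by (simp add: z_def scaleR_right_distrib)
      then have "(1 / (1 + t)) *\<^sub>R x + (t / (1 + t)) *\<^sub>R z = (t / (1 + t) + 1 / (1 + t)) *\<^sub>R y"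
        by (simp add: algebra_simps)
      moreover have "t / (1 + t) + 1 / (1 + t) = 1" using t by (simp add: field_simps)
      ultimately show ?thesis by simp
    qed
    have "F y \<le> (1 / (1 + t)) * F x + (t / (1 + t)) * F z"
    proof -
      have "1 / (1 + t) + t / (1 + t) = 1" using t by (simp add: field_simps)
      then have "F ((1 / (1 + t)) *\<^sub>R x + (t / (1 + t)) *\<^sub>R z)
          \<le> (1 / (1 + t)) * F x + (t / (1 + t)) * F z"
        using conv t unfolding convex_on_def
        by (metis UNIV_I add_nonneg_pos divide_nonneg_pos less_eq_real_def zero_less_one)
      then show ?thesis using y_eq by simp
    qed
    also have "\<dots> = (F x + t * F z) / (1 + t)" by (simp add: add_divide_distrib)
    finally have "F y * (1 + t) \<le> F x + t * F z"
      using t by (simp add: pos_le_divide_eq)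
    then have "F y - F x \<le> t * (F z - F y)" by (simp add: algebra_simps)
    also have "\<dots> \<le> t * (2 * \<bar>B\<bar>)"
      using B[OF z] B[of y] y t by (intro mult_left_mono) auto
    finally show ?thesis by (simp add: t_def dist_norm norm_minus_commute mult.commute)
  qed auto
  have "(2 * \<bar>B\<bar>)-lipschitz_on (cball c r) F"
  proof (rule lipschitz_onI)
    fix x y assume "x \<in> cball c r" "y \<in> cball c r"
    then show "dist (F x) (F y) \<le> 2 * \<bar>B\<bar> * dist x y"
      using onesided[of x y] onesided[of y x] by (simp add: dist_real_def dist_commute)
  qed simp
  then show ?thesis ..
qed

section \<open>Error bounds on polytopes\<close>

text \<open>
  Write \<open>x\<close> as a convex combination of vertices and replace each vertex at which \<open>g\<close> is
  positive by the zero \<open>c\<close> of \<open>g\<close>.  The point moves by at most a constant times the total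
  weight of these vertices, and as \<open>g\<close> is bounded below by some \<open>\<eta> > 0\<close> on the finitely
  many of them, this weight is at most \<open>g x / \<eta>\<close>.
\<close>

lemma polytope_linear_error_bound:
  fixes Q :: "'a::euclidean_space set" and g :: "'a \<Rightarrow> real"
  assumes "polytope Q" and c: "c \<in> Q" and lin: "linear g" and gc: "g c = 0"
    and nonneg: "\<And>x. x \<in> Q \<Longrightarrow> 0 \<le> g x"
  shows "\<exists>K\<ge>0. \<forall>x\<in>Q. \<exists>y\<in>Q. g y = 0 \<and> norm (x - y) \<le> K * g x"
proof -
  obtain V where V: "finite V" "Q = convex hull V"
    using \<open>polytope Q\<close> by (auto simp: polytope_def)
  have VQ: "V \<subseteq> Q" using V hull_subset by metis
  define W where "W = {v \<in> V. g v \<noteq> 0}"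
  have W: "finite W" "W \<subseteq> V" using V by (auto simp: W_def)
  \<comment> \<open>the added \<open>1\<close> only keeps the minimum meaningful when \<open>W\<close> is empty\<close>
  define \<eta> where "\<eta> = Min (insert 1 (g ` W))"
  have "0 < g v" if "v \<in> W" for v
    using that VQ nonneg[of v] by (auto simp: W_def)
  then have "\<eta> > 0"
    using W by (auto simp: \<eta>_def)
  have \<eta>_le: "\<eta> \<le> g v" if "v \<in> W" for v
    using W that by (simp add: \<eta>_def)
  define D where "D = (\<Sum>v\<in>V. norm (v - c))"
  have D: "norm (v - c) \<le> D" if "v \<in> V" for v
    unfolding D_def by (rule member_le_sum[OF that]) (use V in auto)
  have "D \<ge> 0" by (simp add: D_def sum_nonneg)
  have "\<exists>y\<in>Q. g y = 0 \<and> norm (x - y) \<le> D / \<eta> * g x" if "x \<in> Q" for x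
  proof -
    obtain u where u: "\<And>v. v \<in> V \<Longrightarrow> 0 \<le> u v" "sum u V = 1" "(\<Sum>v\<in>V. u v *\<^sub>R v) = x"
      using \<open>x \<in> Q\<close> unfolding V(2) convex_hull_finite[OF V(1)] by blast
    define y where "y = (\<Sum>v\<in>V. u v *\<^sub>R (if v \<in> W then c else v))"
    have "y \<in> Q" unfolding y_def
      using VQ c u V by (intro convex_sum) auto
    moreover have "g y = 0"
      using gc by (auto simp: y_def linear_sum[OF lin] linear_cmul[OF lin] W_def intro!: sum.neutral)
    moreover have "norm (x - y) \<le> D / \<eta> * g x"
    proof -
      have "x - y = (\<Sum>v\<in>V. if v \<in> W then u v *\<^sub>R (v - c) else 0)"
        unfolding u(3)[symmetric] y_def sum_subtractf[symmetric]
        by (intro sum.cong) (auto simp: algebra_simps)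
      also have "norm \<dots> \<le> (\<Sum>v\<in>V. D / \<eta> * (u v * g v))"
      proof (rule sum_norm_le)
        fix v assume v: "v \<in> V"
        show "norm (if v \<in> W then u v *\<^sub>R (v - c) else 0) \<le> D / \<eta> * (u v * g v)"
        proof (cases "v \<in> W")
          case True
          have "D * 1 \<le> D * (g v / \<eta>)"
            using \<eta>_le[OF True] \<open>\<eta> > 0\<close> \<open>D \<ge> 0\<close> by (intro mult_left_mono) auto
          then have "norm (v - c) \<le> D * (g v / \<eta>)"
            using D[OF v] by simp
          then have "u v * norm (v - c) \<le> u v * (D * (g v / \<eta>))"
            using u(1)[OF v] by (rule mult_left_mono)
          then show ?thesis using True u(1)[OF v] by (simp add: mult_ac)
        next
          case False
          then show ?thesis using v by (simp add: W_def)
        qed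
      qed
      also have "\<dots> = D / \<eta> * g x"
        by (simp add: u(3)[symmetric] linear_sum[OF lin] linear_cmul[OF lin] sum_distrib_left)
      finally show ?thesis .
    qed
    ultimately show ?thesis by blast
  qed
  then show ?thesis using \<open>D \<ge> 0\<close> \<open>\<eta> > 0\<close> by (meson divide_nonneg_pos)
qed

text \<open>
  On each orthant \<open>\<Sum>i\<in>I. |x\<^sub>i|\<close> is linear, and if only the coordinates in \<open>I\<close> are
  given a sign, every orthant contains \<open>c\<close>.  So the linear error bound applies to each of
  the finitely many pieces into which the orthants cut \<open>P\<close>.
\<close>

lemma polytope_coordinate_error_bound:
  fixes P :: "(real^'p) set"
  assumes P: "polytope P" and c: "c \<in> P" and c0: "\<And>i. i \<in> I \<Longrightarrow> c $ i = 0"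
  shows "\<exists>K\<ge>0. \<forall>x\<in>P. \<exists>y\<in>P. (\<forall>i\<in>I. y $ i = 0) \<and> norm (x - y) \<le> K * (\<Sum>i\<in>I. \<bar>x $ i\<bar>)"
proof -
  \<comment> \<open>orthants are indexed by the set \<open>S\<close> of coordinates with nonnegative sign\<close>
  define \<sigma> :: "'p set \<Rightarrow> 'p \<Rightarrow> real" where "\<sigma> S i = (if i \<in> S then 1 else -1)" for S i
  define Q where "Q S = P \<inter> (\<Inter>i\<in>I. {x. axis i (\<sigma> S i) \<bullet> x \<ge> 0})" for S
  have Q_iff: "x \<in> Q S \<longleftrightarrow> x \<in> P \<and> (\<forall>i\<in>I. \<sigma> S i * x $ i \<ge> 0)" for x S
    by (auto simp: Q_def inner_axis')
  define g where "g S x = (\<Sum>i\<in>I. \<sigma> S i * x $ i)" for S and x :: "real^'p"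
  have "\<exists>K\<ge>0. \<forall>x\<in>Q S. \<exists>y\<in>Q S. g S y = 0 \<and> norm (x - y) \<le> K * g S x" for S
  proof (rule polytope_linear_error_bound)
    show "polytope (Q S)" unfolding Q_def
      using P by (intro polytope_Int_polyhedron polyhedron_Inter) (auto simp: polyhedron_halfspace_ge)
    show "c \<in> Q S" "g S c = 0" using c c0 by (auto simp: Q_iff g_def)
    show "linear (g S)" unfolding g_def
      by (auto intro!: linearI simp: algebra_simps sum.distrib sum_distrib_left)
    show "0 \<le> g S x" if "x \<in> Q S" for x
      using that by (auto simp: Q_iff g_def intro!: sum_nonneg)
  qed
  then obtain K where K: "\<And>S. K S \<ge> 0"
    "\<And>S x. x \<in> Q S \<Longrightarrow> \<exists>y\<in>Q S. g S y = 0 \<and> norm (x - y) \<le> K S * g S x"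
    by metis
  have K_le: "K S \<le> sum K UNIV" for S
    by (rule member_le_sum) (use K in auto)
  have "\<exists>y\<in>P. (\<forall>i\<in>I. y $ i = 0) \<and> norm (x - y) \<le> sum K UNIV * (\<Sum>i\<in>I. \<bar>x $ i\<bar>)"
    if x: "x \<in> P" for x
  proof -
    define S where "S = {i. x $ i \<ge> 0}"
    have x_abs: "\<sigma> S i * x $ i = \<bar>x $ i\<bar>" for i by (simp add: \<sigma>_def S_def)
    then have "x \<in> Q S" and gx: "g S x = (\<Sum>i\<in>I. \<bar>x $ i\<bar>)"
      using x by (auto simp: Q_iff g_def)
    then obtain y where y: "y \<in> Q S" "g S y = 0" "norm (x - y) \<le> K S * g S x"
      using K(2) by blast
    have "\<forall>i\<in>I. \<sigma> S i * y $ i = 0"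
      using y(1,2) by (subst sum_nonneg_eq_0_iff[symmetric]) (auto simp: g_def Q_iff)
    then have "\<forall>i\<in>I. y $ i = 0" by (auto simp: \<sigma>_def split: if_splits)
    moreover have "K S * g S x \<le> sum K UNIV * g S x"
      using K_le gx by (intro mult_right_mono) (auto intro: sum_nonneg)
    ultimately show ?thesis using y gx by (auto simp: Q_iff)
  qed
  moreover have "sum K UNIV \<ge> 0" using K by (simp add: sum_nonneg)
  ultimately show ?thesis by blast
qed

section \<open>Exact penalization\<close>

text \<open>
  The penalty for the constraints \<open>x\<^sub>i = 0\<close> is exact: the nearby feasible point given by the
  error bound has value at least \<open>F c\<close>, and \<open>F\<close> changes at most by a Lipschitz constant
  times the distance to it.  Intersecting \<open>\<Omega>\<close> with a box makes it a polytope and keeps the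
  feasible point in the region where the Lipschitz constant is valid.
\<close>

lemma convex_exact_penalty:
  fixes F :: "real^'p \<Rightarrow> real"
  assumes F: "convex_on UNIV F" and \<Omega>: "polyhedron \<Omega>" "c \<in> \<Omega>"
    and c0: "\<And>i. i \<in> I \<Longrightarrow> c $ i = 0"
    and opt: "\<And>y. y \<in> \<Omega> \<Longrightarrow> \<forall>i\<in>I. y $ i = 0 \<Longrightarrow> F c \<le> F y"
  shows "\<exists>M\<ge>0. \<forall>x\<in>\<Omega> \<inter> cball c 1. F c \<le> F x + M * (\<Sum>i\<in>I. \<bar>x $ i\<bar>)"
proof -
  obtain a where a: "cball c 1 \<subseteq> cbox (-a) a"
    using bounded_subset_cbox_symmetric[OF bounded_cball] by metis
  define P where "P = cbox (-a) a \<inter> \<Omega>"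
  have P: "polytope P" unfolding P_def
    by (intro polytope_Int_polyhedron polytope_interval \<Omega>)
  have sub: "\<Omega> \<inter> cball c 1 \<subseteq> P" using a by (auto simp: P_def)
  obtain K where K: "K \<ge> 0" "\<And>x. x \<in> P \<Longrightarrow>
      \<exists>y\<in>P. (\<forall>i\<in>I. y $ i = 0) \<and> norm (x - y) \<le> K * (\<Sum>i\<in>I. \<bar>x $ i\<bar>)"
    using polytope_coordinate_error_bound[OF P, of c I] sub \<Omega> c0 by (metis Int_iff centre_in_cball subset_iff zero_le_one)
  obtain R where R: "P \<subseteq> cball c R"
    using polytope_imp_bounded[OF P] bounded_any_center[of P c] by (auto simp: subset_iff)
  obtain L where L: "L-lipschitz_on (cball c R) F"
    using convex_on_UNIV_lipschitz_on_cball[OF F] by blast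
  have "F c \<le> F x + L * K * (\<Sum>i\<in>I. \<bar>x $ i\<bar>)" if x: "x \<in> \<Omega> \<inter> cball c 1" for x
  proof -
    have xP: "x \<in> P" using x sub by blast
    from K(2)[OF this] obtain y where y: "y \<in> P" "\<forall>i\<in>I. y $ i = 0"
      "norm (x - y) \<le> K * (\<Sum>i\<in>I. \<bar>x $ i\<bar>)" by blast
    have "F c \<le> F y" using y by (intro opt) (auto simp: P_def)
    also have "\<dots> \<le> F x + L * norm (x - y)"
    proof -
      have "x \<in> cball c R" "y \<in> cball c R" using R xP y(1) by auto
      from lipschitz_onD[OF L this] show ?thesis by (simp add: dist_real_def dist_norm)
    qed
    also have "\<dots> \<le> F x + L * (K * (\<Sum>i\<in>I. \<bar>x $ i\<bar>))"
      using y(3) lipschitz_on_nonneg[OF L] by (intro add_left_mono mult_left_mono) auto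
    finally show ?thesis by (simp add: mult.assoc)
  qed
  then show ?thesis using K(1) lipschitz_on_nonneg[OF L] by (intro exI[of _ "L * K"]) auto
qed

section \<open>The penalty functions \<open>\<phi>\<close>\<close>

text \<open>
  Chord slopes ending at \<open>b\<close> increase towards their limit \<open>d\<close>.
\<close>

lemma convex_on_above_left_tangent:
  fixes \<psi> :: "real \<Rightarrow> real"
  assumes conv: "convex_on {a..b} \<psi>" and d: "(\<psi> has_real_derivative d) (at_left b)"
    and t: "t \<in> {a..b}"
  shows "\<psi> b + d * (t - b) \<le> \<psi> t"
proof (cases "t = b")
  case False
  then have tb: "t < b" using t by auto
  have "((\<lambda>s. (\<psi> s - \<psi> b) / (s - b)) \<longlongrightarrow> d) (at_left b)"
    using d by (simp add: has_field_derivative_iff)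
  moreover have "\<forall>\<^sub>F s in at_left b. (\<psi> t - \<psi> b) / (t - b) \<le> (\<psi> s - \<psi> b) / (s - b)"
    using eventually_at_left_real[OF tb]
  proof eventually_elim
    case (elim s)
    then show ?case using convex_on_slope_le(2)[OF conv, of t b s] t by auto
  qed
  ultimately have "(\<psi> t - \<psi> b) / (t - b) \<le> d"
    by (rule tendsto_lowerbound) simp
  then show ?thesis using tb by (simp add: divide_le_eq algebra_simps)
qed simp

lemma family_L_real_valued:
  assumes \<phi>: "\<phi> \<in> family_L" and t: "t \<in> {0..1}"
  shows "\<phi> t = ereal (real_of_ereal (\<phi> t))"
proof -
  have "{0..1} \<subseteq> interior (edom \<phi>)" using \<phi> by (simp add: family_L_def)
  then have "t \<in> edom \<phi>" using t interior_subset by blast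
  moreover have "\<phi> t > -\<infinity>" using \<phi> by (auto simp: family_L_def proper_def)
  ultimately show ?thesis by (cases "\<phi> t") (auto simp: edom_def)
qed

lemma family_L_minimizer:
  assumes \<phi>: "\<phi> \<in> family_L"
  obtains t\<^sub>0 where "t\<^sub>0 \<in> {0..<1}" "real_of_ereal (\<phi> t\<^sub>0) = 0"
    and "\<And>t. t \<in> {0..1} \<Longrightarrow> 0 \<le> real_of_ereal (\<phi> t)"
    and "\<And>t. t \<in> {0..1} \<Longrightarrow> real_of_ereal (\<phi> t) \<le> 0 \<Longrightarrow> t = t\<^sub>0"
proof -
  obtain t\<^sub>0 where t\<^sub>0: "{t \<in> {0..1}. \<forall>s\<in>{0..1}. \<phi> t \<le> \<phi> s} = {t\<^sub>0}" "t\<^sub>0 < 1" "\<phi> t\<^sub>0 = 0"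
    using \<phi> by (auto simp: family_L_def)
  then have "t\<^sub>0 \<in> {t \<in> {0..1}. \<forall>s\<in>{0..1}. \<phi> t \<le> \<phi> s}" by blast
  then have min: "t\<^sub>0 \<in> {0..1}" "\<And>s. s \<in> {0..1} \<Longrightarrow> 0 \<le> \<phi> s" using t\<^sub>0(3) by auto
  show thesis
  proof
    show "t\<^sub>0 \<in> {0..<1}" "real_of_ereal (\<phi> t\<^sub>0) = 0" using t\<^sub>0 min by auto
    show "0 \<le> real_of_ereal (\<phi> t)" if "t \<in> {0..1}" for t
      using min(2)[OF that] by (simp add: real_of_ereal_pos)
    show "t = t\<^sub>0" if t: "t \<in> {0..1}" "real_of_ereal (\<phi> t) \<le> 0" for t
    proof -
      have "\<phi> t \<le> 0" using t(2) family_L_real_valued[OF \<phi> t(1)] by (metis ereal_less_eq(3) zero_ereal_def)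
      then have "t \<in> {t \<in> {0..1}. \<forall>s\<in>{0..1}. \<phi> t \<le> \<phi> s}" using min(2) t(1) order_trans by blast
      then show ?thesis using t\<^sub>0(1) by auto
    qed
  qed
qed

lemma P_obj_real:
  fixes w :: "real^'p"
  assumes \<phi>: "\<phi> \<in> family_L" and w: "w \<in> {0..1}"
  shows "P_obj F \<nu> \<phi> (x, w) = ereal (F x + \<nu> * (\<Sum>i\<in>UNIV. real_of_ereal (\<phi> (w $ i))))"
proof -
  have "\<phi> (w $ i) = ereal (real_of_ereal (\<phi> (w $ i)))" for i
    using w by (intro family_L_real_valued[OF \<phi>]) (auto simp: less_eq_vec_def)
  then have "(\<Sum>i\<in>UNIV. \<phi> (w $ i)) = ereal (\<Sum>i\<in>UNIV. real_of_ereal (\<phi> (w $ i)))"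
    by (metis (no_types, lifting) sum.cong sum_ereal)
  then show ?thesis by (simp add: P_obj_def)
qed

section \<open>Partial calmness\<close>

lemma inner_one_minus_abs:
  "(1 - w) \<bullet> \<bar>x\<bar> = (\<Sum>i\<in>UNIV. (1 - w $ i) * \<bar>x $ i\<bar>)" for w x :: "real^'p"
  by (simp add: inner_vec_def abs_vec_def)

lemma S_eps_0_iff:
  fixes x w :: "real^'p"
  shows "(x, w) \<in> S_eps \<Omega> 0 \<longleftrightarrow> x \<in> \<Omega> \<and> w \<in> {0..1} \<and> (\<forall>i. x $ i \<noteq> 0 \<longrightarrow> w $ i = 1)"
proof -
  have "(1 - w) \<bullet> \<bar>x\<bar> = 0 \<longleftrightarrow> (\<forall>i. x $ i \<noteq> 0 \<longrightarrow> w $ i = 1)" if "w \<in> {0..1}"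
    unfolding inner_one_minus_abs using that
    by (subst sum_nonneg_eq_0_iff) (auto simp: less_eq_vec_def)
  then show ?thesis by (auto simp: S_eps_def)
qed

text \<open>
  Where \<open>x\<^sub>i = 0\<close> the complementarity constraint leaves \<open>w\<^sub>i\<close> free, so exchanging that single
  weight for \<open>t\<close> gives a competitor whose objective differs only in the \<open>i\<close>-th term.
\<close>

lemma S_star_weight:
  fixes x w :: "real^'p"
  assumes \<phi>: "\<phi> \<in> family_L" and "\<nu> > 0" and opt: "(x, w) \<in> S_star F \<nu> \<phi> \<Omega>"
    and xi: "x $ i = 0" and t: "t \<in> {0..1}"
  shows "real_of_ereal (\<phi> (w $ i)) \<le> real_of_ereal (\<phi> t)"
proof -
  let ?\<psi> = "\<lambda>t. real_of_ereal (\<phi> t)"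
  have feas: "(x, w) \<in> S_eps \<Omega> 0" using opt by (simp add: S_star_def)
  define w' where "w' = (\<chi> j. if j = i then t else w $ j)"
  have w': "(x, w') \<in> S_eps \<Omega> 0"
    using feas xi t unfolding S_eps_0_iff by (auto simp: w'_def less_eq_vec_def)
  then have "P_obj F \<nu> \<phi> (x, w) \<le> P_obj F \<nu> \<phi> (x, w')"
    using opt by (simp add: S_star_def)
  then have "(\<Sum>j\<in>UNIV. ?\<psi> (w $ j)) \<le> (\<Sum>j\<in>UNIV. ?\<psi> (w' $ j))"
    using feas w' \<open>\<nu> > 0\<close> by (simp add: P_obj_real[OF \<phi>] S_eps_0_iff)
  then show ?thesis
    by (simp add: sum.remove[of UNIV i] w'_def)
qed

text \<open>
  A point \<open>y\<close> whose support lies in that of \<open>x\<close> remains feasible with the same weights \<open>w\<close>.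
\<close>

lemma S_star_point_optimal:
  fixes x y w :: "real^'p"
  assumes \<phi>: "\<phi> \<in> family_L" and opt: "(x, w) \<in> S_star F \<nu> \<phi> \<Omega>"
    and y: "y \<in> \<Omega>" "\<And>i. x $ i = 0 \<Longrightarrow> y $ i = 0"
  shows "F x \<le> F y"
proof -
  have feas: "(x, w) \<in> S_eps \<Omega> 0" using opt by (simp add: S_star_def)
  then have y': "(y, w) \<in> S_eps \<Omega> 0" using y by (auto simp: S_eps_0_iff)
  then have "P_obj F \<nu> \<phi> (x, w) \<le> P_obj F \<nu> \<phi> (y, w)"
    using opt by (simp add: S_star_def)
  then show ?thesis using feas by (simp add: P_obj_real[OF \<phi>] S_eps_0_iff)
qed

text \<open>
  With \<open>\<rho>\<close> large enough, the \<open>i\<close>-th term \<open>\<nu> * (\<phi> w\<^sub>i + \<rho> * (1 - w\<^sub>i) * |x\<^sub>i|)\<close> exceeds its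
  optimal value by at least \<open>M * |x\<^sub>i|\<close> where \<open>x\<^sub>0\<close> vanishes and does not fall below it
  elsewhere.  The sum of these gains covers the decrease of \<open>F\<close> that
  \<open>convex_exact_penalty\<close> permits.
\<close>

theorem convex_partially_calm_over:
  fixes F :: "real^'p \<Rightarrow> real"
  assumes F: "convex_on UNIV F" and \<Omega>: "polyhedron \<Omega>" and \<nu>: "\<nu> > 0" and \<phi>: "\<phi> \<in> family_L"
    and d: "((\<lambda>t. real_of_ereal (\<phi> t)) has_real_derivative d) (at_left 1)"
  shows "partially_calm_over F \<nu> \<phi> \<Omega> (S_star F \<nu> \<phi> \<Omega>)"
  unfolding partially_calm_over_def
proof (clarify)
  fix x\<^sub>0 w\<^sub>0 assume opt: "(x\<^sub>0, w\<^sub>0) \<in> S_star F \<nu> \<phi> \<Omega>"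
  define \<psi> where "\<psi> t = real_of_ereal (\<phi> t)" for t
  have feas: "x\<^sub>0 \<in> \<Omega>" "w\<^sub>0 \<in> {0..1}" "\<And>i. x\<^sub>0 $ i \<noteq> 0 \<Longrightarrow> w\<^sub>0 $ i = 1"
    using opt by (auto simp: S_star_def S_eps_0_iff simp del: atLeastAtMost_iff)
  have box: "w $ i \<in> {0..1}" if "w \<in> {0..1}" for w :: "real^'p" and i
    using that by (auto simp: less_eq_vec_def)
  obtain t\<^sub>0 where t\<^sub>0: "t\<^sub>0 \<in> {0..<1}" "\<psi> t\<^sub>0 = 0" "\<And>t. t \<in> {0..1} \<Longrightarrow> 0 \<le> \<psi> t"
      "\<And>t. t \<in> {0..1} \<Longrightarrow> \<psi> t \<le> 0 \<Longrightarrow> t = t\<^sub>0"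
    using family_L_minimizer[OF \<phi>] unfolding \<psi>_def by metis
  have \<psi>1: "\<psi> 1 = 1" using \<phi> by (simp add: \<psi>_def family_L_def)
  have tangent: "1 - d * (1 - t) \<le> \<psi> t" if "t \<in> {0..1}" for t
  proof -
    have "convex_on {0..1} \<psi>" "(\<psi> has_real_derivative d) (at_left 1)"
      using \<phi> d by (simp_all add: \<psi>_def[abs_def] family_L_def)
    from convex_on_above_left_tangent[OF this that] show ?thesis
      by (simp add: \<psi>1 algebra_simps)
  qed
  have w\<^sub>0: "w\<^sub>0 $ i = t\<^sub>0" if "x\<^sub>0 $ i = 0" for i
    using S_star_weight[OF \<phi> \<nu> opt that, of t\<^sub>0] t\<^sub>0 box[OF feas(2)] by (force simp: \<psi>_def)
  define J where "J = {i. x\<^sub>0 $ i = 0}"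
  obtain M where M: "M \<ge> 0"
    "\<And>x. x \<in> \<Omega> \<inter> cball x\<^sub>0 1 \<Longrightarrow> F x\<^sub>0 \<le> F x + M * (\<Sum>i\<in>J. \<bar>x $ i\<bar>)"
    using convex_exact_penalty[OF F \<Omega> feas(1), of J] S_star_point_optimal[OF \<phi> opt]
    by (auto simp: J_def)
  define c where "c = Min (insert 1 ((\<lambda>i. \<bar>x\<^sub>0 $ i\<bar>) ` (- J)))"
  have c: "0 < c" "c \<le> 1" "\<And>i. i \<notin> J \<Longrightarrow> c \<le> \<bar>x\<^sub>0 $ i\<bar>"
    by (auto simp: c_def J_def)
  define \<kappa> where "\<kappa> = (1 - t\<^sub>0) / 2"
  have \<kappa>: "\<kappa> > 0" using t\<^sub>0(1) by (simp add: \<kappa>_def)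
  \<comment> \<open>Within \<open>\<delta>\<close> of the optimum, \<open>|x\<^sub>i| \<ge> c / 2\<close> off \<open>J\<close> and \<open>1 - w\<^sub>i \<ge> \<kappa>\<close> on \<open>J\<close>.  The last two
    summands of \<open>\<rho>\<close> then outweigh the slope \<open>d\<close> off \<open>J\<close> and the penalty constant \<open>M\<close> on \<open>J\<close>.
    Having \<open>c \<le> 1\<close> keeps \<open>x\<close> in the unit ball on which \<open>M\<close> is valid.\<close>
  define \<delta> where "\<delta> = min (c / 2) \<kappa>"
  define \<rho> where "\<rho> = 1 + 2 * \<bar>d\<bar> / c + M / (\<nu> * \<kappa>)"
  have \<rho>: "\<rho> > 0" "2 * \<bar>d\<bar> / c \<le> \<rho>" "M / (\<nu> * \<kappa>) \<le> \<rho>"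
    using c M \<nu> \<kappa> by (auto simp: \<rho>_def add_pos_nonneg)
  have main: "F x\<^sub>0 + \<nu> * (\<Sum>i\<in>UNIV. \<psi> (w\<^sub>0 $ i))
      \<le> F x + \<nu> * (\<Sum>i\<in>UNIV. \<psi> (w $ i)) + \<rho> * \<nu> * ((1 - w) \<bullet> \<bar>x\<bar>)"
    if dist: "dist (x\<^sub>0, w\<^sub>0) (x, w) \<le> \<delta>" and x: "x \<in> \<Omega>" and w: "w \<in> {0..1}" for x w
  proof -
    have dx: "dist x\<^sub>0 x \<le> \<delta>" and dw: "dist w\<^sub>0 w \<le> \<delta>"
      using dist dist_fst_le[of "(x\<^sub>0, w\<^sub>0)" "(x, w)"] dist_snd_le[of "(x\<^sub>0, w\<^sub>0)" "(x, w)"] by auto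
    have dxi: "\<bar>x\<^sub>0 $ i - x $ i\<bar> \<le> c / 2" and dwi: "\<bar>w\<^sub>0 $ i - w $ i\<bar> \<le> \<kappa>" for i
      using dist_vec_nth_le[of x\<^sub>0 i x] dist_vec_nth_le[of w\<^sub>0 i w] dx dw
      by (auto simp: \<delta>_def dist_real_def)
    have "F x\<^sub>0 \<le> F x + M * (\<Sum>i\<in>J. \<bar>x $ i\<bar>)"
      using M(2)[of x] x dx c by (auto simp: \<delta>_def)
    also have "M * (\<Sum>i\<in>J. \<bar>x $ i\<bar>) = (\<Sum>i\<in>UNIV. if i \<in> J then M * \<bar>x $ i\<bar> else 0)"
      by (simp add: sum_distrib_left sum.If_cases)
    also have "\<dots> \<le> (\<Sum>i\<in>UNIV. \<nu> * (\<psi> (w $ i) + \<rho> * ((1 - w $ i) * \<bar>x $ i\<bar>) - \<psi> (w\<^sub>0 $ i)))"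
    proof (rule sum_mono)
      fix i
      have wi: "w $ i \<in> {0..1}" by (rule box[OF w])
      show "(if i \<in> J then M * \<bar>x $ i\<bar> else 0)
        \<le> \<nu> * (\<psi> (w $ i) + \<rho> * ((1 - w $ i) * \<bar>x $ i\<bar>) - \<psi> (w\<^sub>0 $ i))"
      proof (cases "i \<in> J")
        case True
        then have wi0: "w\<^sub>0 $ i = t\<^sub>0" using w\<^sub>0 by (simp add: J_def)
        then have "\<kappa> \<le> 1 - w $ i" using dwi[of i] unfolding \<kappa>_def by argo
        then have "M / (\<nu> * \<kappa>) * (\<kappa> * \<bar>x $ i\<bar>) \<le> \<rho> * ((1 - w $ i) * \<bar>x $ i\<bar>)"
          using \<rho> \<kappa> by (intro mult_mono mult_right_mono) auto
        then have "M * \<bar>x $ i\<bar> \<le> \<nu> * (\<rho> * ((1 - w $ i) * \<bar>x $ i\<bar>))"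
          using \<nu> \<kappa> by (simp add: field_simps)
        also have "\<dots> \<le> \<nu> * (\<psi> (w $ i) + \<rho> * ((1 - w $ i) * \<bar>x $ i\<bar>) - \<psi> (w\<^sub>0 $ i))"
          using t\<^sub>0(2) t\<^sub>0(3)[OF wi] \<nu> wi0 by (intro mult_left_mono) auto
        finally show ?thesis using True by simp
      next
        case False
        then have wi0: "w\<^sub>0 $ i = 1" using feas(3) by (simp add: J_def)
        have "c / 2 \<le> \<bar>x $ i\<bar>" using dxi[of i] c(3)[OF False] by linarith
        then have "2 * \<bar>d\<bar> / c * (c / 2) \<le> \<rho> * \<bar>x $ i\<bar>"
          using \<rho> c(1) by (intro mult_mono) auto
        then have "d \<le> \<rho> * \<bar>x $ i\<bar>" using c(1) by simp
        then have "d * (1 - w $ i) \<le> \<rho> * \<bar>x $ i\<bar> * (1 - w $ i)"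
          using wi by (intro mult_right_mono) auto
        then have "0 \<le> \<psi> (w $ i) + \<rho> * ((1 - w $ i) * \<bar>x $ i\<bar>) - \<psi> (w\<^sub>0 $ i)"
          using tangent[OF wi] wi0 \<psi>1 by (simp add: mult_ac)
        then show ?thesis using False \<nu> by simp
      qed
    qed
    also have "\<dots> = \<nu> * (\<Sum>i\<in>UNIV. \<psi> (w $ i)) + \<rho> * \<nu> * ((1 - w) \<bullet> \<bar>x\<bar>)
        - \<nu> * (\<Sum>i\<in>UNIV. \<psi> (w\<^sub>0 $ i))"
      unfolding inner_one_minus_abs sum_distrib_left sum.distrib[symmetric] sum_subtractf[symmetric]
      by (intro sum.cong refl) (simp add: algebra_simps)
    finally show ?thesis by simp
  qed
  have obj: "P_obj F \<nu> \<phi> (x, w) = ereal (F x + \<nu> * (\<Sum>i\<in>UNIV. \<psi> (w $ i)))"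
    if "w \<in> {0..1}" for x w
    unfolding \<psi>_def by (rule P_obj_real[OF \<phi> that])
  have "0 \<le> P_obj F \<nu> \<phi> (x, w) - P_obj F \<nu> \<phi> (x\<^sub>0, w\<^sub>0) + ereal (\<rho> * \<nu> * ((1 - w) \<bullet> \<bar>x\<bar>))"
    if "(x, w) \<in> cball (x\<^sub>0, w\<^sub>0) \<delta> \<inter> S_eps \<Omega> \<epsilon>" for x w \<epsilon>
  proof -
    have *: "dist (x\<^sub>0, w\<^sub>0) (x, w) \<le> \<delta>" "x \<in> \<Omega>" "w \<in> {0..1}"
      using that by (auto simp: S_eps_def)
    show ?thesis using main[OF *] by (simp add: obj[OF *(3)] obj[OF feas(2)])
  qed
  moreover have "\<delta> > 0" using c \<kappa> by (simp add: \<delta>_def)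
  ultimately show "partially_calm_at F \<nu> \<phi> \<Omega> (x\<^sub>0, w\<^sub>0)"
    unfolding partially_calm_at_def using \<rho>(1) by blast
qed

section \<open>Convexity of the regularized objective\<close>

lemma convex_on_norm_power2: "convex_on UNIV (\<lambda>x::'a::real_inner. (norm x)\<^sup>2)"
proof -
  have "(norm (u *\<^sub>R x + v *\<^sub>R y))\<^sup>2 \<le> u * (norm x)\<^sup>2 + v * (norm y)\<^sup>2"
    if "u \<ge> 0" "v \<ge> 0" "u + v = 1" for u v and x y :: 'a
  proof -
    have "norm (u *\<^sub>R x + v *\<^sub>R y) \<le> u * norm x + v * norm y"
      using norm_triangle_ineq[of "u *\<^sub>R x" "v *\<^sub>R y"] that by simp
    then have "(norm (u *\<^sub>R x + v *\<^sub>R y))\<^sup>2 \<le> (u * norm x + v * norm y)\<^sup>2"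
      by (intro power_mono) auto
    also have "\<dots> \<le> u * (norm x)\<^sup>2 + v * (norm y)\<^sup>2"
      using convex_power2 that by (auto simp: convex_on_def)
    finally show ?thesis .
  qed
  then show ?thesis by (auto simp: convex_on_def)
qed

lemma convex_on_F_mu:
  fixes f :: "real^'n \<Rightarrow> real" and A :: "real^'p^'n"
  assumes f: "convex_on UNIV f" and "\<mu> \<ge> 0"
  shows "convex_on UNIV (F_mu f A b \<mu>)"
proof -
  have "convex_on UNIV (\<lambda>x. f (A *v x - b))"
  proof -
    have "A *v (u *\<^sub>R x + v *\<^sub>R y) - b = u *\<^sub>R (A *v x - b) + v *\<^sub>R (A *v y - b)"
      if "u + v = 1" for u v :: real and x y
    proof -
      have "b = (u + v) *\<^sub>R b" using that by simp
      then show ?thesis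
        by (simp add: matrix_vector_right_distrib matrix_vector_mult_scaleR algebra_simps)
    qed
    then show ?thesis using f by (auto simp: convex_on_def)
  qed
  moreover have "convex_on UNIV (\<lambda>x::real^'p. \<mu> / 2 * (norm x)\<^sup>2)"
    using \<open>\<mu> \<ge> 0\<close> convex_on_norm_power2 by (intro convex_on_cmul) auto
  ultimately show ?thesis unfolding F_mu_def by (rule convex_on_add)
qed

theorem proposition3p1:
  fixes f :: "real^'n \<Rightarrow> real" and A :: "real^'p^'n" and b :: "real^'n"
    and \<Omega> :: "(real^'p) set" and \<mu> \<nu> :: real and \<phi> :: "real \<Rightarrow> ereal"
  assumes "\<And>y. f y \<ge> 0" and "convex_on UNIV f" and "piecewise_linear_quadratic f"
    and "\<Omega> \<noteq> {}" and "polyhedron \<Omega>"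
    and "\<mu> > 0" and "\<nu> > 0"
    and "\<phi> \<in> family_L"
    (* the left derivative of phi at 1 is finite; without this the claim fails, e.g. for
       phi t = 1 - sqrt (1 - t) on {0..1} *)
    and "\<exists>d. ((\<lambda>t. real_of_ereal (\<phi> t)) has_real_derivative d) (at_left 1)"
  shows "partially_calm_over (F_mu f A b \<mu>) \<nu> \<phi> \<Omega> (S_star (F_mu f A b \<mu>) \<nu> \<phi> \<Omega>)"
proof -
  obtain d where d: "((\<lambda>t. real_of_ereal (\<phi> t)) has_real_derivative d) (at_left 1)"
    using assms(9) by blast
  have "convex_on UNIV (F_mu f A b \<mu>)"
    using assms(2,6) by (simp add: convex_on_F_mu)
  then show ?thesis
    using assms(5,7,8) d by (rule convex_partially_calm_over)
qed

end
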